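(* For each integer $n\ge 1$ let $V_n:\{0,1,\dots,n\}\to\mathbb R$ be a function such that the finite sequence $\{V_n(r)\}_{r=0}^n$ is unimodal. Put $\Delta_n(r)=V_n(r)-V_n(r-1)$ for $r\in\{1,\dots,n\}$. Suppose there exist a sequence $\{k_n\}_{n\ge1}$ of positive constants and constants $A<0$, $c\in(0,1)$, $\ell\in(0,1)$ such that $D_n(r)=k_n\Delta_n(r)$ satisfies $$\sup_{\substack{|u|<2\\ \ell n+u\in\{1,\dots,n\}}}\left|D_n(\ell n+u)-A(u-c)\right|\longrightarrow 0\qquad (n\to\infty).$$ (a) If $\ell$ is irrational, then for every continued-fraction convergent $p/q$ of $\ell$ (in lowest terms, $q>0$) with $q$ sufficiently large, $p$ is the unique maximizer of $V_q$ over $\{0,\dots,q\}$. (b) If $\ell=a/b$ is rational in lowest terms (with $a,b$ positive integers), then for every sufficiently large integer $m$, $am$ is the unique maximizer of $V_{bm}$ over $\{0,\dots,bm\}$.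
   Context: A finite real sequence $\{V(r)\}_{r=0}^n$ is unimodal if there exist $0\le a\le b\le n$ with $V(0)\le\cdots\le V(a)=\cdots=V(b)\ge\cdots\ge V(n)$. The supremum is over real $u$ with $|u|<2$ such that $\ell n+u$ is an integer in $\{1,\dots,n\}$. Convergents of $\ell$ are those of its simple (regular) continued fraction expansion. *)

theory Defs
  imports "HOL-Analysis.Analysis"
begin

definition unimodal :: "nat \<Rightarrow> (nat \<Rightarrow> real) \<Rightarrow> bool" where
  "unimodal n f \<longleftrightarrow> (\<exists>a b. a \<le> b \<and> b \<le> n
     \<and> (\<forall>i. i < a \<longrightarrow> f i \<le> f (Suc i))
     \<and> (\<forall>i. a \<le> i \<and> i < b \<longrightarrow> f i = f (Suc i))
     \<and> (\<forall>i. b \<le> i \<and> i < n \<longrightarrow> f i \<ge> f (Suc i)))"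

text \<open>Only meaningful for \<open>r \<ge> 1\<close>, because of truncated subtraction.\<close>

definition bdiff :: "(nat \<Rightarrow> real) \<Rightarrow> nat \<Rightarrow> real" where
  "bdiff f r = f r - f (r - 1)"

text \<open>The \<open>k\<close>-th complete quotient \<open>x\<^sub>k\<close> in the simple continued fraction
  algorithm \<open>x\<^sub>0 = x\<close>, \<open>x\<^sub>k\<^sub>+\<^sub>1 = 1 / (x\<^sub>k - \<lfloor>x\<^sub>k\<rfloor>)\<close>. The algorithm
  does not stop when \<open>x\<close> is irrational.\<close>

primrec cf_tail :: "real \<Rightarrow> nat \<Rightarrow> real" where
  "cf_tail x 0 = x"
| "cf_tail x (Suc k) = 1 / frac (cf_tail x k)"

definition cf_coeff :: "real \<Rightarrow> nat \<Rightarrow> int" where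
  "cf_coeff x k = \<lfloor>cf_tail x k\<rfloor>"

text \<open>\<open>fin_cf a k\<close> is the value of the finite continued fraction
  \<open>a 0 + 1 / (a 1 + 1 / (\<dots> + 1 / a k))\<close>.\<close>

fun fin_cf :: "(nat \<Rightarrow> int) \<Rightarrow> nat \<Rightarrow> real" where
  "fin_cf a 0 = of_int (a 0)"
| "fin_cf a (Suc k) = of_int (a 0) + 1 / fin_cf (\<lambda>i. a (Suc i)) k"

definition cf_convergents :: "real \<Rightarrow> real set" where
  "cf_convergents x = {fin_cf (cf_coeff x) k | k. True}"

definition maximizers :: "nat \<Rightarrow> (nat \<Rightarrow> real) \<Rightarrow> nat set" where
  "maximizers n f = {r. is_arg_max f (\<lambda>s. s \<in> {0..n}) r}"

end

theory Submission
  imports Defs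
begin

text \<open>
  If \<open>n\<close> is large and \<open>p\<close> is an integer with \<open>u = p - l n\<close> close enough to \<open>0\<close>, then \<open>D\<^sub>n(p)\<close>
  is close to \<open>A (u - c) > 0\<close> and \<open>D\<^sub>n(p + 1)\<close> is close to \<open>A (u + 1 - c) < 0\<close>. So \<open>p\<close> is a strict
  local maximum of \<open>V\<^sub>n\<close>, and by unimodality the unique global one. In (b) one has \<open>u = 0\<close>; in (a)
  a convergent satisfies \<open>\<bar>p - l q\<bar> \<le> 1 / q\<close>.
\<close>

section \<open>Strict peaks of unimodal sequences\<close>

text \<open>The strict rise into \<open>p\<close> cannot lie on or after the plateau, and the strict
  fall after \<open>p\<close> cannot lie before or on it. Hence the plateau is the single point
  \<open>p\<close>, and monotonicity on each side carries the strict inequality to all other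
  indices.\<close>

lemma unimodal_strict_peak:
  assumes "unimodal n f" "1 \<le> p" "p < n" "f (p - 1) < f p" "f (Suc p) < f p"
  shows "maximizers n f = {p}"
proof -
  obtain a b where "a \<le> b" "b \<le> n"
    and up: "\<And>i. i < a \<Longrightarrow> f i \<le> f (Suc i)"
    and flat: "\<And>i. a \<le> i \<Longrightarrow> i < b \<Longrightarrow> f i = f (Suc i)"
    and down: "\<And>i. b \<le> i \<Longrightarrow> i < n \<Longrightarrow> f i \<ge> f (Suc i)"
    using assms(1) unfolding unimodal_def by blast
  have "Suc (p - 1) = p"
    using assms(2) by simp
  have "p - 1 < a"
    using flat[of "p - 1"] down[of "p - 1"] \<open>Suc (p - 1) = p\<close> assms(3,4) by force
  moreover have "b \<le> p"
    using up[of p] flat[of p] assms(5) by force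
  ultimately have ab: "a = p" "b = p"
    using \<open>a \<le> b\<close> by auto
  have below: "f r < f p" if "r < p" for r
  proof -
    have "r \<le> p - 1"
      using that by simp
    then have "f r \<le> f (p - 1)"
    proof (induction r rule: inc_induct)
      case (step m)
      then have "f m \<le> f (Suc m)"
        using ab by (intro up) simp
      then show ?case
        using step by simp
    qed simp
    then show ?thesis
      using assms(4) by simp
  qed
  have above: "f r < f p" if "p < r" "r \<le> n" for r
  proof -
    have "f r \<le> f (Suc p)"
      using that(1)[THEN Suc_leI] that(2)
    proof (induction r rule: dec_induct)
      case (step m)
      then show ?case
        using down[of m] ab by auto
    qed simp
    then show ?thesis
      using assms(5) by simp
  qed
  have "f r < f p" if "r \<le> n" "r \<noteq> p" for r
    using below above that by (meson nat_neq_iff)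
  then show ?thesis
    using assms(3) unfolding maximizers_def is_arg_max_def
    by (auto simp: not_less) (metis not_less less_imp_le_nat, metis less_le order_refl)
qed

section \<open>Approximation by continued fraction convergents\<close>

text \<open>\<open>cf_tail\<close> recurses at its last step, \<open>fin_cf\<close> at its first.
  Peeling off the first step here too lets an induction pass from \<open>x\<close> to
  \<open>1 / frac x\<close>.\<close>

lemma cf_tail_Suc_shift: "cf_tail x (Suc k) = cf_tail (1 / frac x) k"
  by (induction k) auto

lemma cf_coeff_Suc_shift: "(\<lambda>i. cf_coeff x (Suc i)) = cf_coeff (1 / frac x)"
  unfolding cf_coeff_def cf_tail_Suc_shift ..

lemma recip_frac_irrational:
  fixes x :: real
  assumes "x \<notin> \<rat>"
  shows "1 / frac x \<notin> \<rat>" "1 / frac x > 1"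
proof -
  have "frac x \<notin> \<rat>"
    using assms by (auto simp: frac_def dest: Rats_add[OF _ Rats_of_int[of "\<lfloor>x\<rfloor>"]])
  then show "1 / frac x \<notin> \<rat>"
    by (metis Rats_divide Rats_1 divide_divide_eq_right div_by_1 mult_1)
  have "frac x \<noteq> 0"
    using \<open>frac x \<notin> \<rat>\<close> by (metis Rats_0)
  then show "1 / frac x > 1"
    using frac_ge_0[of x] frac_lt_1[of x] by simp
qed

lemma cf_tail_gt_1:
  assumes "x \<notin> \<rat>"
  shows "cf_tail x (Suc k) > 1"
proof -
  have "cf_tail x k \<notin> \<rat>" for k
    by (induction k) (use assms recip_frac_irrational(1) in auto)
  then show ?thesis
    using recip_frac_irrational(2) by simp
qed

text \<open>\<open>h / d\<close> and \<open>h' / d'\<close> are two consecutive convergents. The induction step inverts the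
  fraction, which is why the sign conditions on \<open>h\<close> and \<open>h'\<close> are carried along.\<close>

lemma fin_cf_matrix:
  assumes "x \<notin> \<rat>"
  obtains h h' d d' :: int where
    "d > 0" "d' \<ge> 0" "x > 1 \<Longrightarrow> h > 0 \<and> h' \<ge> 0" "\<bar>h * d' - h' * d\<bar> = 1"
    "fin_cf (cf_coeff x) k = h / d"
    "x * (d * cf_tail x (Suc k) + d') = h * cf_tail x (Suc k) + h'"
proof -
  have "\<exists>h h' d d'. d > 0 \<and> d' \<ge> 0 \<and> (x > 1 \<longrightarrow> h > 0 \<and> h' \<ge> 0) \<and> \<bar>h * d' - h' * d\<bar> = 1 \<and>
      fin_cf (cf_coeff x) k = of_int h / of_int d \<and>
      x * (of_int d * cf_tail x (Suc k) + of_int d') = of_int h * cf_tail x (Suc k) + of_int h'"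
    using assms
  proof (induction k arbitrary: x)
    case 0
    have "frac x \<noteq> 0"
      using recip_frac_irrational(2)[OF 0] by (metis div_by_0 not_one_less_zero)
    then have "x * (1 / frac x) = \<lfloor>x\<rfloor> * (1 / frac x) + 1"
      by (simp add: field_simps) (simp add: frac_def)
    moreover have "x > 1 \<longrightarrow> \<lfloor>x\<rfloor> > 0"
      by linarith
    \<comment> \<open>The witnesses \<open>h = \<lfloor>x\<rfloor>\<close>, \<open>d = 1\<close>,
      \<open>h' = 1\<close>, \<open>d' = 0\<close> are the zeroth convergent and the formal
      convergent 1/0 preceding it.\<close>
    ultimately show ?case
      by - (rule exI[of _ "\<lfloor>x\<rfloor>"], rule exI[of _ 1], rule exI[of _ 1], rule exI[of _ 0],
          auto simp: cf_coeff_def)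
  next
    case (Suc k)
    define y where "y = 1 / frac x"
    define t where "t = cf_tail y (Suc k)"
    have y: "y \<notin> \<rat>" "y > 1"
      unfolding y_def using recip_frac_irrational[OF Suc.prems] by auto
    have "t > 1"
      unfolding t_def using y(1) by (rule cf_tail_gt_1)
    obtain h h' d d' :: int where IH: "d > 0" "d' \<ge> 0" "h > 0" "h' \<ge> 0"
      "\<bar>h * d' - h' * d\<bar> = 1" "fin_cf (cf_coeff y) k = h / d"
      "y * (d * t + d') = h * t + h'"
      using Suc.IH[OF y(1)] y(2) unfolding t_def by blast
    let ?a = "\<lfloor>x\<rfloor>"
    have x: "x = ?a + 1 / y"
      unfolding y_def by (simp add: frac_def)
    have tail: "cf_tail x (Suc (Suc k)) = t"
      unfolding t_def y_def by (rule cf_tail_Suc_shift)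
    have cf: "fin_cf (cf_coeff x) (Suc k) = ?a + 1 / (h / d)"
      using IH(6) by (simp add: cf_coeff_Suc_shift y_def) (simp add: cf_coeff_def)
    \<comment> \<open>Since \<open>x = ?a + 1 / y\<close>, the matrix for \<open>x\<close> is the
      one for \<open>y\<close> multiplied on the left by the matrix with rows (\<open>?a\<close>, 1)
      and (1, 0).\<close>
    have "x * (h * t + h') = ?a * (h * t + h') + (1 / y) * (y * (d * t + d'))"
      by (subst x) (simp add: IH(7) distrib_right)
    also have "\<dots> = (?a * h + d) * t + (?a * h' + d')"
      using y(2) by (simp add: algebra_simps)
    finally have eq: "x * (h * t + h') = (?a * h + d) * t + (?a * h' + d')" .
    \<comment> \<open>The left factor has determinant -1, so the sign alternates and only the
      absolute value is invariant.\<close>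
    have "\<bar>(?a * h + d) * h' - (?a * h' + d') * h\<bar> = 1"
      using IH(5) by (simp add: algebra_simps abs_minus_commute)
    moreover have "?a * h + d > 0 \<and> ?a * h' + d' \<ge> 0" if "x > 1"
    proof -
      have "?a \<ge> 1"
        using that by linarith
      then show ?thesis
        using IH by (simp add: add_nonneg_pos)
    qed
    moreover have "fin_cf (cf_coeff x) (Suc k) = (?a * h + d) / h"
      unfolding cf using IH(1,3) by (simp add: field_simps)
    ultimately show ?case
      using IH(3,4) eq unfolding tail
      by - (rule exI[of _ "?a * h + d"], rule exI[of _ "?a * h' + d'"], rule exI[of _ h],
          rule exI[of _ h'], auto)
  qed
  then show thesis
    using that by blast
qed

text \<open>For the \<open>h / d\<close> of \<open>fin_cf_matrix\<close>, the error
  \<open>h - x * d\<close> is, up to sign, the reciprocal of \<open>d * t + d'\<close>, which is at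
  least \<open>d\<close>. The bound is then transferred from \<open>h / d\<close> to the reduced
  fraction \<open>p / q\<close>.\<close>

lemma cf_convergent_approx:
  fixes p q :: nat and x :: real
  assumes "x \<notin> \<rat>" "q > 0" "coprime p q" "p / q \<in> cf_convergents x"
  shows "\<bar>p - x * q\<bar> \<le> 1 / q"
proof -
  obtain k where k: "p / q = fin_cf (cf_coeff x) k"
    using assms(4) unfolding cf_convergents_def by blast
  define t where "t = cf_tail x (Suc k)"
  have "t > 1"
    unfolding t_def using assms(1) by (rule cf_tail_gt_1)
  obtain h h' d d' :: int where d: "d > 0" "d' \<ge> 0" and det: "\<bar>h * d' - h' * d\<bar> = 1"
    and cf: "fin_cf (cf_coeff x) k = h / d" and x: "x * (d * t + d') = h * t + h'"
    using fin_cf_matrix[OF assms(1), of k] unfolding t_def by metis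
  have "real_of_int d \<le> d * t"
    using d \<open>t > 1\<close> by simp
  then have dt: "real_of_int d \<le> d * t + d'"
    using d(2) by (intro add_increasing2) auto
  \<comment> \<open>Substituting the relation for \<open>x\<close> cancels every term containing
    \<open>t\<close> and leaves the determinant.\<close>
  have "(h - x * d) * (d * t + d') = h * (d * t + d') - d * (x * (d * t + d'))"
    by (simp add: algebra_simps)
  also have "\<dots> = h * d' - h' * d"
    unfolding x by (simp add: algebra_simps)
  finally have "\<bar>h - x * d\<bar> * \<bar>d * t + d'\<bar> = \<bar>of_int (h * d' - h' * d)\<bar>"
    by (simp flip: abs_mult)
  also have "\<dots> = 1"
    using det by (metis of_int_1 of_int_abs)
  finally have "\<bar>h - x * d\<bar> * d \<le> 1"
    using dt d by (metis abs_ge_zero abs_of_nonneg mult_left_mono of_int_0_le_iff order_trans less_imp_le)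
  \<comment> \<open>As \<open>p / q\<close> is in lowest terms, equality with \<open>h / d\<close>
    gives that \<open>q\<close> divides \<open>d\<close>; the resulting \<open>q \<le> d\<close> is
    enough for the transfer.\<close>
  have cross: "real p * d = h * q"
    using k cf assms(2) d by (simp add: field_simps)
  then have "int p * d = h * int q"
    by (metis of_int_eq_iff of_int_mult of_int_of_nat_eq)
  then have "int q dvd int p * d"
    by simp
  then have "int q dvd d"
    using assms(3) by (metis coprime_commute coprime_dvd_mult_right_iff coprime_int_iff)
  then have "real q \<le> d"
    using d(1) zdvd_imp_le by fastforce
  have "\<bar>p - x * q\<bar> * d = \<bar>(p - x * q) * d\<bar>"
    using d by (simp add: abs_mult)
  also have "(p - x * q) * d = (h - x * d) * q"
    using cross by (simp add: algebra_simps)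
  also have "\<bar>\<dots>\<bar> \<le> \<bar>h - x * d\<bar> * d"
    using \<open>real q \<le> d\<close> by (simp add: abs_mult mult_left_mono)
  also have "\<dots> \<le> 1"
    by fact
  finally have "\<bar>p - x * q\<bar> * d \<le> 1" .
  moreover have "\<bar>p - x * q\<bar> * q \<le> \<bar>p - x * q\<bar> * d"
    using \<open>real q \<le> d\<close> by (intro mult_left_mono) auto
  ultimately show ?thesis
    using assms(2) by (simp add: field_simps)
qed

section \<open>Locating the maximizer near the line\<close>

text \<open>The common core of (a) and (b): a tolerance \<delta> independent of \<open>n\<close>
  reduces both to bounding the distance from \<open>p\<close> to \<open>l * n\<close>.\<close>

lemma maximizers_near_line:
  fixes V :: "nat \<Rightarrow> nat \<Rightarrow> real" and k :: "nat \<Rightarrow> real" and A c l :: real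
  assumes unimod: "\<And>n. n \<ge> 1 \<Longrightarrow> unimodal n (V n)"
    and k_pos: "\<And>n. n \<ge> 1 \<Longrightarrow> k n > 0"
    and A_neg: "A < 0"
    and c_range: "c \<in> {0<..<1}"
    and l_range: "l \<in> {0<..<1}"
    and lim: "(\<lambda>n. Sup {\<bar>k n * bdiff (V n) r - A * (u - c)\<bar> | (u::real) (r::nat).
                          \<bar>u\<bar> < 2 \<and> r \<in> {1..n} \<and> l * real n + u = real r})
              \<longlonglongrightarrow> 0"
  obtains \<delta> N where "\<delta> > 0"
    "\<And>n p. n \<ge> N \<Longrightarrow> \<bar>real p - l * real n\<bar> \<le> \<delta> \<Longrightarrow> maximizers n (V n) = {p}"
proof -
  define S where "S n = {\<bar>k n * bdiff (V n) r - A * (u - c)\<bar> | (u::real) (r::nat).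
                          \<bar>u\<bar> < 2 \<and> r \<in> {1..n} \<and> l * real n + u = real r}" for n
  \<comment> \<open>Half the distance from \<open>c\<close> to the nearer of 0 and 1. For
    \<open>u = p - l * n\<close> with absolute value at most \<delta>, both \<open>c - u\<close> and
    \<open>u + 1 - c\<close> are at least \<delta>, so an error below \<open>- A * \<delta>\<close>
    cannot change the signs of the two differences.\<close>
  define \<delta> where "\<delta> = min c (1 - c) / 2"
  have \<delta>: "\<delta> > 0" "\<delta> < 1" "2 * \<delta> \<le> c" "2 * \<delta> \<le> 1 - c"
    using c_range by (auto simp: \<delta>_def)
  have "- A * \<delta> > 0"
    using A_neg \<delta> by (simp add: mult_neg_pos)
  then have "\<forall>\<^sub>F n in sequentially. Sup (S n) < - A * \<delta>"
    using lim unfolding S_def by (intro order_tendstoD(2)) auto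
  \<comment> \<open>These bounds keep \<open>l * n\<close> at distance at least 2 from both 0 and
    \<open>n\<close>, so that \<open>p\<close> and \<open>Suc p\<close> lie in
    \<open>{1..n}\<close>.\<close>
  moreover have "\<forall>\<^sub>F n in sequentially. real n \<ge> 2 / l"
    "\<forall>\<^sub>F n in sequentially. real n \<ge> 2 / (1 - l)"
    by (simp_all add: eventually_sequentially_Suc real_arch_simple nat_ceiling_le_eq
        eventually_ge_at_top filterlim_at_top[THEN iffD1, OF filterlim_real_sequentially, rule_format])
  ultimately have "\<forall>\<^sub>F n in sequentially.
      Sup (S n) < - A * \<delta> \<and> real n \<ge> 2 / l \<and> real n \<ge> 2 / (1 - l)"
    by eventually_elim simp
  then obtain N where N: "\<And>n. n \<ge> N \<Longrightarrow> Sup (S n) < - A * \<delta>"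
    "\<And>n. n \<ge> N \<Longrightarrow> real n \<ge> 2 / l" "\<And>n. n \<ge> N \<Longrightarrow> real n \<ge> 2 / (1 - l)"
    unfolding eventually_sequentially by blast
  have "maximizers n (V n) = {p}" if "n \<ge> N" "\<bar>real p - l * real n\<bar> \<le> \<delta>" for n p
  proof -
    have ln: "l * n \<ge> 2" "n - l * n \<ge> 2"
      using N(2,3)[OF that(1)] l_range by (auto simp: field_simps)
    have p: "1 \<le> p" "p < n"
      using ln that(2) \<delta>(2) by linarith+
    have Suc_near: "\<bar>Suc p - l * n\<bar> < 2"
      using that(2) \<delta>(2) by (simp add: abs_less_iff abs_le_iff)
    have close: "\<bar>k n * bdiff (V n) r - A * (r - l * n - c)\<bar> < - A * \<delta>"
      if "r \<in> {1..n}" "\<bar>r - l * n\<bar> < 2" for r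
    proof -
      \<comment> \<open>A real \<open>Sup\<close> bounds the members of a set only if the set is
        bounded above. Here \<open>r\<close> determines \<open>u\<close>, so \<open>S n\<close> is
        finite.\<close>
      have "S n \<subseteq> (\<lambda>r. \<bar>k n * bdiff (V n) r - A * (r - l * n - c)\<bar>) ` {1..n}"
      proof
        fix y
        assume "y \<in> S n"
        then obtain u r where "y = \<bar>k n * bdiff (V n) r - A * (u - c)\<bar>" "r \<in> {1..n}" "l * n + u = r"
          unfolding S_def by blast
        moreover from this have "u = r - l * n"
          by simp
        ultimately show "y \<in> (\<lambda>r. \<bar>k n * bdiff (V n) r - A * (r - l * n - c)\<bar>) ` {1..n}"
          by blast
      qed
      then have "bdd_above (S n)"
        by (meson bdd_above_finite finite_atLeastAtMost finite_imageI finite_subset)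
      moreover have "\<bar>k n * bdiff (V n) r - A * (r - l * n - c)\<bar> \<in> S n"
        unfolding S_def using that by force
      ultimately show ?thesis
        using N(1)[OF \<open>n \<ge> N\<close>] cSup_upper by fastforce
    qed
    have "k n > 0"
      using k_pos p by simp
    have "- A * \<delta> \<le> - A * (c - (p - l * n))"
      using A_neg that(2) \<delta> by (intro mult_left_mono) auto
    then have "k n * bdiff (V n) p > 0"
      using close[of p] p that(2) \<delta>(2) by (auto simp: algebra_simps)
    moreover have "- A * \<delta> \<le> - A * (Suc p - l * n - c)"
      using A_neg that(2) \<delta> by (intro mult_left_mono) auto
    then have "k n * bdiff (V n) (Suc p) < 0"
      using close[of "Suc p", OF _ Suc_near] p by (auto simp: algebra_simps)
    ultimately have "V n (p - 1) < V n p" "V n (Suc p) < V n p"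
      using \<open>k n > 0\<close> by (auto simp: bdiff_def zero_less_mult_iff mult_less_0_iff)
    then show ?thesis
      using unimodal_strict_peak unimod p by simp
  qed
  then show thesis
    using that \<delta>(1) by blast
qed

theorem corollary2p2:
  fixes V :: "nat \<Rightarrow> nat \<Rightarrow> real" and k :: "nat \<Rightarrow> real" and A c l :: real
  assumes unimod: "\<And>n. n \<ge> 1 \<Longrightarrow> unimodal n (V n)"
    and k_pos: "\<And>n. n \<ge> 1 \<Longrightarrow> k n > 0"
    and A_neg: "A < 0"
    and c_range: "c \<in> {0<..<1}"
    and l_range: "l \<in> {0<..<1}"
    and lim: "(\<lambda>n. Sup {\<bar>k n * bdiff (V n) r - A * (u - c)\<bar> | (u::real) (r::nat).
                          \<bar>u\<bar> < 2 \<and> r \<in> {1..n} \<and> l * real n + u = real r})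
              \<longlonglongrightarrow> 0"
  shows "(l \<notin> \<rat> \<longrightarrow>
           (\<exists>Q. \<forall>p q :: nat. q > 0 \<and> coprime p q \<and> real p / real q \<in> cf_convergents l \<and> q \<ge> Q
                  \<longrightarrow> maximizers q (V q) = {p}))
       \<and> (\<forall>a b :: nat. a > 0 \<and> b > 0 \<and> coprime a b \<and> l = real a / real b \<longrightarrow>
           (\<exists>M. \<forall>m\<ge>M. maximizers (b * m) (V (b * m)) = {a * m}))"
proof -
  obtain \<delta> N where "\<delta> > 0"
    and max: "\<And>n p. n \<ge> N \<Longrightarrow> \<bar>real p - l * real n\<bar> \<le> \<delta> \<Longrightarrow> maximizers n (V n) = {p}"
    using maximizers_near_line[OF assms] by blast
  have "\<exists>Q. \<forall>p q :: nat. q > 0 \<and> coprime p q \<and> real p / real q \<in> cf_convergents l \<and> q \<ge> Q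
      \<longrightarrow> maximizers q (V q) = {p}" if "l \<notin> \<rat>"
  \<comment> \<open>The second entry of the maximum makes the approximation error
    \<open>1 / q\<close> at most \<delta>.\<close>
  proof (intro exI[of _ "max N (nat \<lceil>1 / \<delta>\<rceil>)"] allI impI)
    fix p q :: nat
    assume *: "q > 0 \<and> coprime p q \<and> real p / real q \<in> cf_convergents l \<and> q \<ge> max N (nat \<lceil>1 / \<delta>\<rceil>)"
    then have "1 / \<delta> \<le> q"
      by (simp add: nat_ceiling_le_eq)
    then have "1 / q \<le> \<delta>"
      using * \<open>\<delta> > 0\<close> by (simp add: field_simps)
    then show "maximizers q (V q) = {p}"
      using * cf_convergent_approx[OF that, of q p] by (intro max) auto
  qed
  moreover have "\<exists>M. \<forall>m\<ge>M. maximizers (b * m) (V (b * m)) = {a * m}"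
    if "b > 0" "l = real a / real b" for a b :: nat
  \<comment> \<open>Here \<open>a * m\<close> lies exactly on the line, and
    \<open>b * m \<ge> m\<close>, so the threshold \<open>N\<close> for \<open>n\<close> also serves
    for \<open>m\<close>.\<close>
  proof (intro exI[of _ N] allI impI max)
    fix m assume "N \<le> m"
    also have "m \<le> b * m"
      using that(1) by simp
    finally show "N \<le> b * m" .
    show "\<bar>real (a * m) - l * real (b * m)\<bar> \<le> \<delta>"
      using that \<open>\<delta> > 0\<close> by simp
  qed
  ultimately show ?thesis
    by blast
qed

end
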